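(* The radius of convexity of the class $\mathcal{F}_H^0$ is $1/2$. That is, every $f\in\mathcal{F}_H^0$ is convex in $|z|<1/2$, and the bound $1/2$ is sharp: for no $\rho\in(1/2,1]$ is every $f\in\mathcal{F}_H^0$ convex in $|z|<\rho$.
   Context: $\mathbb{D}=\{z\in\mathbb{C}:|z|<1\}$. $\mathcal{F}_H^0$ is the class of all complex-valued harmonic functions $f$ in $\mathbb{D}$ with $f(0)=0$, $f_z(0)=1$, $f_{\bar z}(0)=0$ and $|f_z(z)-1|<1-|f_{\bar z}(z)|$ for all $z\in\mathbb{D}$. Such an $f$ is called convex in $|z|<\rho$ if $\frac{\partial}{\partial\theta}\left(\arg\left\{\frac{\partial}{\partial\theta}f(re^{i\theta})\right\}\right)>0$ for all $0<r<\rho$ and $0\le\theta\le 2\pi$. The radius of convexity of a class is the largest $\rho\in(0,1]$ such that every function in the class is convex in $|z|<\rho$. *)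

theory Defs
  imports "HOL-Complex_Analysis.Complex_Analysis"
begin

definition partial_x :: "(complex \<Rightarrow> complex) \<Rightarrow> complex \<Rightarrow> complex" where
  "partial_x f z = frechet_derivative f (at z) 1"

definition partial_y :: "(complex \<Rightarrow> complex) \<Rightarrow> complex \<Rightarrow> complex" where
  "partial_y f z = frechet_derivative f (at z) \<i>"

definition wirtinger_z :: "(complex \<Rightarrow> complex) \<Rightarrow> complex \<Rightarrow> complex" where
  "wirtinger_z f z = (partial_x f z - \<i> * partial_y f z) / 2"

definition wirtinger_zbar :: "(complex \<Rightarrow> complex) \<Rightarrow> complex \<Rightarrow> complex" where
  "wirtinger_zbar f z = (partial_x f z + \<i> * partial_y f z) / 2"

(* \<open>differentiable\<close> is differentiability over the reals. The first three conjuncts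
   after openness make all second-order partial derivatives exist, so that together with
   their continuity f is of class C^2 on S; the last conjunct is Laplace's equation. *)
definition harmonic_on :: "(complex \<Rightarrow> complex) \<Rightarrow> complex set \<Rightarrow> bool" where
  "harmonic_on f S \<longleftrightarrow> open S \<and>
     (\<forall>z\<in>S. f differentiable (at z)) \<and>
     (\<forall>z\<in>S. partial_x f differentiable (at z)) \<and>
     (\<forall>z\<in>S. partial_y f differentiable (at z)) \<and>
     continuous_on S (partial_x (partial_x f)) \<and>
     continuous_on S (partial_y (partial_x f)) \<and>
     continuous_on S (partial_x (partial_y f)) \<and>
     continuous_on S (partial_y (partial_y f)) \<and>
     (\<forall>z\<in>S. partial_x (partial_x f) z + partial_y (partial_y f) z = 0)"

(* Functions are total in HOL; the values of f outside the unit disc are irrelevant. *)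
definition F_H0 :: "(complex \<Rightarrow> complex) set" where
  "F_H0 = {f. harmonic_on f (ball 0 1) \<and> f 0 = 0 \<and>
     wirtinger_z f 0 = 1 \<and> wirtinger_zbar f 0 = 0 \<and>
     (\<forall>z\<in>ball 0 1. cmod (wirtinger_z f z - 1) < 1 - cmod (wirtinger_zbar f z))}"

definition circle_tangent :: "(complex \<Rightarrow> complex) \<Rightarrow> real \<Rightarrow> real \<Rightarrow> complex" where
  "circle_tangent f r \<theta> = vector_derivative (\<lambda>t. f (of_real r * cis t)) (at \<theta>)"

(* The argument of a nowhere vanishing curve w is a continuous branch: the principal
   value Arg jumps and could not be differentiated along a closed curve. Two such branches
   differ by a constant, so the derivative does not depend on the choice. *)
definition arg_branch :: "(real \<Rightarrow> complex) \<Rightarrow> (real \<Rightarrow> real) \<Rightarrow> bool" where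
  "arg_branch w \<phi> \<longleftrightarrow>
     continuous_on UNIV \<phi> \<and> (\<forall>t. w t \<noteq> 0 \<and> is_Arg (w t) (\<phi> t))"

definition convex_in_disc :: "(complex \<Rightarrow> complex) \<Rightarrow> real \<Rightarrow> bool" where
  "convex_in_disc f \<rho> \<longleftrightarrow>
     (\<forall>r. 0 < r \<and> r < \<rho> \<longrightarrow>
        (\<exists>\<phi>. arg_branch (circle_tangent f r) \<phi> \<and>
             (\<forall>\<theta>\<in>{0..2 * pi}. \<exists>d>0. (\<phi> has_real_derivative d) (at \<theta>))))"

definition is_radius_of_convexity :: "(complex \<Rightarrow> complex) set \<Rightarrow> real \<Rightarrow> bool" where
  "is_radius_of_convexity C \<rho> \<longleftrightarrow>
     \<rho> \<in> {0<..1} \<and> (\<forall>f\<in>C. convex_in_disc f \<rho>) \<and>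
     (\<forall>\<rho>'\<in>{0<..1}. (\<forall>f\<in>C. convex_in_disc f \<rho>') \<longrightarrow> \<rho>' \<le> \<rho>)"

end

theory Submission
  imports Defs
begin

text \<open>
  Write \<open>f = h + cnj g\<close> with \<open>h\<close> and \<open>g\<close> analytic, and put \<open>p = f\<^sub>z = h'\<close> and
  \<open>q = cnj f\<^sub>z\<^sub>b\<^sub>a\<^sub>r = g'\<close>.  The tangent of the image of the circle \<open>z = r cis \<theta>\<close> is
  \<open>\<i> (z p - cnj (z q))\<close>, and the derivative of its argument is the real part of
  \<open>(A + cnj B) / (P - cnj Q)\<close>, where \<open>P = z p\<close>, \<open>Q = z q\<close>, \<open>A = z P'\<close> and \<open>B = z Q'\<close>, with
  the prime denoting \<open>d/dz\<close>.

  The harmonic problem reduces to an analytic one.  Suppose that at one point \<open>z\<close> the curvature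
  expression \<open>(A + \<epsilon> B) / (P + \<epsilon> Q)\<close> of every analytic function \<open>h + \<epsilon> g\<close> with \<open>|\<epsilon>| = 1\<close>
  has positive real part.  For \<open>\<epsilon> = W / cnj W\<close> with \<open>W = P - cnj Q\<close> the number \<open>P + \<epsilon> Q\<close> is a
  positive multiple of \<open>W\<close>, and \<open>\<epsilon> B / W\<close> is the conjugate of \<open>cnj B / W\<close>; so the real part for
  this \<open>\<epsilon>\<close> has the sign of the real part for \<open>f\<close> (\<open>Re_divide_pos_of_rotations\<close>).

  For \<open>f\<close> in the class, \<open>p + \<epsilon> q = 1 + \<omega>\<close> with \<open>\<omega> 0 = 0\<close> and \<open>|\<omega>| < 1\<close>, and the analytic
  curvature expression is \<open>1 + z \<omega>' / (1 + \<omega>)\<close>.  With \<open>r = |z|\<close> and \<open>s = |\<omega> z|\<close>, the Schwarz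
  lemma gives \<open>s \<le> r\<close> and the Schwarz-Pick inequality gives
  \<open>|z \<omega>'| \<le> r (1 - s\<^sup>2) / (1 - r\<^sup>2)\<close>.  This is less than \<open>1 - s \<le> |1 + \<omega>|\<close> as soon as
  \<open>r (1 + r) < 1 - r\<^sup>2\<close>, that is, \<open>r < 1/2\<close> (\<open>analytic_curvature_bound\<close>).

  The analytic function \<open>z + z\<^sup>2 / 2\<close> shows sharpness: its curvature expression
  \<open>(1 + 2 z) / (1 + z)\<close> is negative at \<open>z = - r\<close> for \<open>1/2 < r < 1\<close>.
\<close>

section \<open>Mixed second derivatives\<close>

text \<open>
  The mean value theorem is applied once along \<open>a\<close> and once along \<open>b\<close>.  The left side is
  symmetric in \<open>a\<close> and \<open>b\<close>, which is what forces mixed derivatives to agree.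
\<close>

lemma second_difference_mean_value:
  fixes u ua uab :: "'a::real_normed_vector \<Rightarrow> real"
  assumes h: "0 < h"
    and sub: "\<And>s t. 0 \<le> s \<Longrightarrow> s \<le> h \<Longrightarrow> 0 \<le> t \<Longrightarrow> t \<le> h \<Longrightarrow> z + s *\<^sub>R a + t *\<^sub>R b \<in> S"
    and ua: "\<And>z. z \<in> S \<Longrightarrow> ((\<lambda>t. u (z + t *\<^sub>R a)) has_real_derivative ua z) (at 0)"
    and uab: "\<And>z. z \<in> S \<Longrightarrow> ((\<lambda>t. ua (z + t *\<^sub>R b)) has_real_derivative uab z) (at 0)"
  obtains s t where "0 < s" "s < h" "0 < t" "t < h"
    "u (z + h *\<^sub>R a + h *\<^sub>R b) - u (z + h *\<^sub>R a) - u (z + h *\<^sub>R b) + u z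
       = h\<^sup>2 * uab (z + s *\<^sub>R a + t *\<^sub>R b)"
proof -
  have ua': "((\<lambda>s. u (z + s *\<^sub>R a + t *\<^sub>R b)) has_real_derivative ua (z + s *\<^sub>R a + t *\<^sub>R b)) (at s)"
    if "0 \<le> s" "s \<le> h" "0 \<le> t" "t \<le> h" for s t
    using ua[OF sub[OF that]] DERIV_shift[of "\<lambda>s. u (z + s *\<^sub>R a + t *\<^sub>R b)" _ 0 s]
    by (simp add: algebra_simps)
  have uab': "((\<lambda>t. ua (z + s *\<^sub>R a + t *\<^sub>R b)) has_real_derivative uab (z + s *\<^sub>R a + t *\<^sub>R b)) (at t)"
    if "0 \<le> s" "s \<le> h" "0 \<le> t" "t \<le> h" for s t
    using uab[OF sub[OF that]] DERIV_shift[of "\<lambda>t. ua (z + s *\<^sub>R a + t *\<^sub>R b)" _ 0 t]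
    by (simp add: algebra_simps)
  define g where "g s = u (z + s *\<^sub>R a + h *\<^sub>R b) - u (z + s *\<^sub>R a + 0 *\<^sub>R b)" for s
  have "(g has_real_derivative ua (z + s *\<^sub>R a + h *\<^sub>R b) - ua (z + s *\<^sub>R a + 0 *\<^sub>R b)) (at s)"
    if "0 \<le> s" "s \<le> h" for s
    unfolding g_def using h that by (intro DERIV_diff ua') auto
  from MVT2[OF h this] obtain s where s: "0 < s" "s < h"
    and gs: "g h - g 0 = h * (ua (z + s *\<^sub>R a + h *\<^sub>R b) - ua (z + s *\<^sub>R a + 0 *\<^sub>R b))"
    by auto
  obtain t where t: "0 < t" "t < h"
    and "ua (z + s *\<^sub>R a + h *\<^sub>R b) - ua (z + s *\<^sub>R a + 0 *\<^sub>R b) = h * uab (z + s *\<^sub>R a + t *\<^sub>R b)"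
    using MVT2[OF h uab', of s] s by auto
  with gs have "g h - g 0 = h\<^sup>2 * uab (z + s *\<^sub>R a + t *\<^sub>R b)"
    by (simp add: power2_eq_square)
  then show ?thesis
    using s t by (intro that[of s t]) (simp_all add: g_def algebra_simps)
qed

text \<open>
  If the two mixed derivatives differed at \<open>z\<close>, then by continuity their values on a small
  parallelogram at \<open>z\<close> would be separated; but each of them takes, somewhere in that
  parallelogram, the value of the same second difference quotient.
\<close>

lemma mixed_directional_derivatives_commute:
  fixes u ua ub uab uba :: "'a::real_normed_vector \<Rightarrow> real"
  assumes S: "open S" "z \<in> S"
    and ua: "\<And>z. z \<in> S \<Longrightarrow> ((\<lambda>t. u (z + t *\<^sub>R a)) has_real_derivative ua z) (at 0)"
    and ub: "\<And>z. z \<in> S \<Longrightarrow> ((\<lambda>t. u (z + t *\<^sub>R b)) has_real_derivative ub z) (at 0)"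
    and uab: "\<And>z. z \<in> S \<Longrightarrow> ((\<lambda>t. ua (z + t *\<^sub>R b)) has_real_derivative uab z) (at 0)"
    and uba: "\<And>z. z \<in> S \<Longrightarrow> ((\<lambda>t. ub (z + t *\<^sub>R a)) has_real_derivative uba z) (at 0)"
    and cont: "continuous_on S uab" "continuous_on S uba"
  shows "uab z = uba z"
proof (rule ccontr)
  define d where "d = \<bar>uab z - uba z\<bar> / 2"
  assume "uab z \<noteq> uba z"
  then have "d > 0" by (simp add: d_def)
  have "isCont uab z" "isCont uba z"
    using cont S continuous_on_eq_continuous_at by blast+
  obtain d1 where d1: "d1 > 0" "\<And>w. dist w z < d1 \<Longrightarrow> dist (uab w) (uab z) < d"
    using \<open>isCont uab z\<close> \<open>d > 0\<close> unfolding continuous_at_eps_delta by blast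
  obtain d2 where d2: "d2 > 0" "\<And>w. dist w z < d2 \<Longrightarrow> dist (uba w) (uba z) < d"
    using \<open>isCont uba z\<close> \<open>d > 0\<close> unfolding continuous_at_eps_delta by blast
  obtain d3 where d3: "d3 > 0" "ball z d3 \<subseteq> S"
    using S open_contains_ball by blast
  define e where "e = min d1 (min d2 d3)"
  have "e > 0" using d1 d2 d3 by (simp add: e_def)
  \<comment> \<open>the parallelogram with sides \<open>h a\<close> and \<open>h b\<close> then lies in the ball of radius \<open>e\<close> about \<open>z\<close>\<close>
  define h where "h = e / (2 * (norm a + norm b + 1))"
  have pos: "norm a + norm b + 1 > 0"
    by (smt (verit) norm_ge_zero)
  have h: "h > 0"
    using \<open>e > 0\<close> pos by (simp add: h_def)
  have near: "dist (z + s *\<^sub>R a + t *\<^sub>R b) z < e"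
    if "0 \<le> s" "s \<le> h" "0 \<le> t" "t \<le> h" for s t
  proof -
    have "norm (s *\<^sub>R a + t *\<^sub>R b) \<le> s * norm a + t * norm b"
      using that norm_triangle_ineq[of "s *\<^sub>R a" "t *\<^sub>R b"] by simp
    also have "\<dots> \<le> h * norm a + h * norm b"
      using that by (intro add_mono mult_right_mono) auto
    also have "\<dots> < 2 * (h * (norm a + norm b + 1))"
      using h by (simp add: algebra_simps add_nonneg_pos add_pos_nonneg)
    also have "\<dots> = e"
      using pos by (simp add: h_def field_simps)
    finally show ?thesis
      by (simp add: dist_norm add.assoc)
  qed
  then have sub: "z + s *\<^sub>R a + t *\<^sub>R b \<in> S" if "0 \<le> s" "s \<le> h" "0 \<le> t" "t \<le> h" for s t
    using d3 that by (force simp: e_def dist_commute)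
  have sub': "z + t *\<^sub>R b + s *\<^sub>R a \<in> S" if "0 \<le> t" "t \<le> h" "0 \<le> s" "s \<le> h" for s t
    using sub that by (simp add: add.commute add.left_commute)
  obtain s t where st: "0 < s" "s < h" "0 < t" "t < h"
    and eq1: "u (z + h *\<^sub>R a + h *\<^sub>R b) - u (z + h *\<^sub>R a) - u (z + h *\<^sub>R b) + u z
       = h\<^sup>2 * uab (z + s *\<^sub>R a + t *\<^sub>R b)"
    using second_difference_mean_value[OF h sub ua uab] by blast
  obtain t' s' where st': "0 < t'" "t' < h" "0 < s'" "s' < h"
    and eq2: "u (z + h *\<^sub>R b + h *\<^sub>R a) - u (z + h *\<^sub>R b) - u (z + h *\<^sub>R a) + u z
       = h\<^sup>2 * uba (z + t' *\<^sub>R b + s' *\<^sub>R a)"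
    using second_difference_mean_value[OF h sub' ub uba] by blast
  have "h\<^sup>2 * uab (z + s *\<^sub>R a + t *\<^sub>R b) = h\<^sup>2 * uba (z + s' *\<^sub>R a + t' *\<^sub>R b)"
    using eq1 eq2 by (simp add: algebra_simps)
  then have "uab (z + s *\<^sub>R a + t *\<^sub>R b) = uba (z + s' *\<^sub>R a + t' *\<^sub>R b)"
    using h by simp
  moreover have "dist (uab (z + s *\<^sub>R a + t *\<^sub>R b)) (uab z) < d"
    using near[of s t] st by (intro d1) (auto simp: e_def)
  moreover have "dist (uba (z + s' *\<^sub>R a + t' *\<^sub>R b)) (uba z) < d"
    using near[of s' t'] st' by (intro d2) (auto simp: e_def)
  ultimately show False
    using abs_triangle_ineq[of "uab z - uba (z + s' *\<^sub>R a + t' *\<^sub>R b)" "uba (z + s' *\<^sub>R a + t' *\<^sub>R b) - uba z"]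
    by (simp add: d_def dist_real_def abs_minus_commute)
qed

lemma has_derivative_along_line:
  assumes "(f has_derivative D) (at z)"
  shows "((\<lambda>t. f (z + t *\<^sub>R a)) has_vector_derivative D a) (at 0)"
proof -
  have "((\<lambda>t. z + t *\<^sub>R a) has_vector_derivative a) (at 0)"
    by (auto intro!: derivative_eq_intros)
  then show ?thesis
    using vector_derivative_diff_chain_within[of "\<lambda>t. z + t *\<^sub>R a" a 0 UNIV f D] assms
    by (simp add: o_def has_derivative_at_withinI)
qed

lemma harmonic_on_mixed_partials:
  assumes "harmonic_on f S" "z \<in> S"
  shows "partial_y (partial_x f) z = partial_x (partial_y f) z"
proof -
  note har = assms(1)[unfolded harmonic_on_def]
  have der: "((\<lambda>t. g (w + t *\<^sub>R a)) has_vector_derivative frechet_derivative g (at w) a) (at 0)"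
    if "g differentiable (at w)" for g :: "complex \<Rightarrow> complex" and w a
    using has_derivative_along_line[OF that[unfolded frechet_derivative_works]] .
  have comm: "L (partial_y (partial_x f) z) = L (partial_x (partial_y f) z)"
    if L: "bounded_linear L" for L :: "complex \<Rightarrow> real"
  proof (rule mixed_directional_derivatives_commute[where S = S and a = 1 and b = \<i>
        and uab = "\<lambda>z. L (partial_y (partial_x f) z)" and uba = "\<lambda>z. L (partial_x (partial_y f) z)"])
    have L': "((\<lambda>t. L (g (w + t *\<^sub>R a))) has_real_derivative L (frechet_derivative g (at w) a)) (at 0)"
      if "g differentiable (at w)" for g :: "complex \<Rightarrow> complex" and w a
      using bounded_linear.has_vector_derivative[OF L der[OF that]]
      by (simp add: has_real_derivative_iff_has_vector_derivative)
    show "((\<lambda>t. L (f (w + t *\<^sub>R 1))) has_real_derivative L (partial_x f w)) (at 0)"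
      "((\<lambda>t. L (f (w + t *\<^sub>R \<i>))) has_real_derivative L (partial_y f w)) (at 0)"
      "((\<lambda>t. L (partial_x f (w + t *\<^sub>R \<i>))) has_real_derivative L (partial_y (partial_x f) w)) (at 0)"
      "((\<lambda>t. L (partial_y f (w + t *\<^sub>R 1))) has_real_derivative L (partial_x (partial_y f) w)) (at 0)"
      if "w \<in> S" for w
      using L' har that
      by (simp_all add: partial_x_def[of f w] partial_y_def[of f w]
          partial_x_def[of "partial_y f" w] partial_y_def[of "partial_x f" w])
    show "continuous_on S (\<lambda>z. L (partial_y (partial_x f) z))"
      "continuous_on S (\<lambda>z. L (partial_x (partial_y f) z))"
      using har by (auto intro: bounded_linear.continuous_on[OF L])
  qed (use har assms in auto)
  show ?thesis
    using comm[OF bounded_linear_Re] comm[OF bounded_linear_Im] by (rule complex_eqI)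
qed

section \<open>The Wirtinger derivatives of a harmonic function\<close>

text \<open>
  The Cauchy-Riemann equations in invariant form: a real-linear map that commutes with
  multiplication by \<open>\<i>\<close> is complex-linear.
\<close>

lemma has_field_derivative_if_commutes_with_ii:
  assumes D: "(f has_derivative D) (at z)" and ii: "D \<i> = \<i> * D 1"
  shows "(f has_field_derivative D 1) (at z)"
proof -
  interpret D: bounded_linear D
    using D by (rule has_derivative_bounded_linear)
  have "D h = D 1 * h" for h
  proof -
    have "D h = D (Re h *\<^sub>R 1 + Im h *\<^sub>R \<i>)"
      by (rule arg_cong[of _ _ D]) (simp add: complex_eq_iff)
    also have "\<dots> = D 1 * h"
      unfolding D.add D.scaleR ii by (simp add: complex_eq_iff)
    finally show ?thesis .
  qed
  then have "D = (*) (D 1)" by (rule ext)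
  then show ?thesis
    using D by (simp add: has_field_derivative_def)
qed

text \<open>
  The Cauchy-Riemann equation for \<open>f\<^sub>x - \<i> f\<^sub>y\<close> is exactly Laplace's equation for \<open>f\<close> together
  with \<open>f\<^sub>x\<^sub>y = f\<^sub>y\<^sub>x\<close>; the same computation applies to the conjugate of \<open>f\<^sub>x + \<i> f\<^sub>y\<close>.
\<close>

lemma harmonic_on_wirtinger_holomorphic:
  assumes "harmonic_on f S"
  shows "wirtinger_z f holomorphic_on S" "(\<lambda>z. cnj (wirtinger_zbar f z)) holomorphic_on S"
proof -
  note har = assms[unfolded harmonic_on_def]
  have *: "\<exists>c. (wirtinger_z f has_field_derivative c) (at z)"
    "\<exists>c. ((\<lambda>z. cnj (wirtinger_zbar f z)) has_field_derivative c) (at z)" if "z \<in> S" for z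
  proof -
    let ?X = "frechet_derivative (partial_x f) (at z)"
    let ?Y = "frechet_derivative (partial_y f) (at z)"
    have X: "(partial_x f has_derivative ?X) (at z)" and Y: "(partial_y f has_derivative ?Y) (at z)"
      using har that by (simp_all flip: frechet_derivative_works)
    have sym: "?X \<i> = ?Y 1"
      using harmonic_on_mixed_partials[OF assms that] by (simp add: partial_x_def partial_y_def)
    have "?X 1 + ?Y \<i> = 0"
      using har that by (auto simp: partial_x_def partial_y_def)
    then have lap: "?Y \<i> = - ?X 1"
      by (simp add: eq_neg_iff_add_eq_0 add.commute)
    have "(wirtinger_z f has_derivative (\<lambda>h. (?X h - \<i> * ?Y h) / 2)) (at z)"
      unfolding wirtinger_z_def[abs_def] using X Y by (auto intro!: derivative_eq_intros)
    from has_field_derivative_if_commutes_with_ii[OF this]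
    show "\<exists>c. (wirtinger_z f has_field_derivative c) (at z)"
      by (auto simp: sym lap field_simps)
    have "((\<lambda>z. cnj (wirtinger_zbar f z)) has_derivative (\<lambda>h. cnj ((?X h + \<i> * ?Y h) / 2))) (at z)"
      unfolding wirtinger_zbar_def[abs_def] using X Y by (intro has_derivative_cnj) (auto intro!: derivative_eq_intros)
    from has_field_derivative_if_commutes_with_ii[OF this]
    show "\<exists>c. ((\<lambda>z. cnj (wirtinger_zbar f z)) has_field_derivative c) (at z)"
      by (auto simp: sym lap field_simps)
  qed
  show "wirtinger_z f holomorphic_on S" "(\<lambda>z. cnj (wirtinger_zbar f z)) holomorphic_on S"
    using * har by (auto simp: holomorphic_on_open)
qed

lemma frechet_derivative_wirtinger:
  assumes "f differentiable (at z)"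
  shows "frechet_derivative f (at z) h = wirtinger_z f z * h + wirtinger_zbar f z * cnj h"
proof -
  let ?D = "frechet_derivative f (at z)"
  interpret D: bounded_linear ?D
    using assms unfolding frechet_derivative_works by (rule has_derivative_bounded_linear)
  have "?D h = ?D (Re h *\<^sub>R 1 + Im h *\<^sub>R \<i>)"
    by (rule arg_cong[of _ _ ?D]) (simp add: complex_eq_iff)
  also have "\<dots> = wirtinger_z f z * h + wirtinger_zbar f z * cnj h"
    unfolding D.add D.scaleR wirtinger_z_def wirtinger_zbar_def partial_x_def partial_y_def
    by (simp add: complex_eq_iff field_simps)
  finally show ?thesis .
qed

section \<open>The argument along a curve\<close>

text \<open>
  Differentiating the polar form \<open>w = |w| exp (\<i> \<phi>)\<close> gives \<open>w' / w = |w|' / |w| + \<i> \<phi>'\<close>, so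
  the derivative does not depend on the branch.
\<close>

lemma arg_branch_derivative:
  assumes \<phi>: "arg_branch w \<phi>"
    and w': "(w has_vector_derivative w') (at t)" and d: "(\<phi> has_real_derivative d) (at t)"
  shows "d = Im (w' / w t)"
proof -
  have nz: "w s \<noteq> 0" and polar: "w s = of_real (norm (w s)) * exp (\<i> * of_real (\<phi> s))" for s
    using \<phi> by (auto simp: arg_branch_def is_Arg_def)
  have "(\<lambda>s. norm (w s)) differentiable (at t)"
    using w' nz by (intro differentiable_compose[of norm w] differentiable_norm_at)
      (auto intro: differentiableI_vector)
  then obtain n' where n': "((\<lambda>s. norm (w s)) has_real_derivative n') (at t)"
    using real_differentiable_def by blast
  let ?e = "exp (\<i> * of_real (\<phi> t))"
  have "((\<lambda>s. of_real (norm (w s))) has_vector_derivative complex_of_real n') (at t)"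
    using n' by (intro has_vector_derivative_of_real) (simp flip: has_real_derivative_iff_has_vector_derivative)
  moreover have "((\<lambda>s. exp (\<i> * of_real (\<phi> s))) has_vector_derivative (\<i> * of_real d * ?e)) (at t)"
  proof -
    have "((\<lambda>s. \<i> * of_real (\<phi> s)) has_vector_derivative (\<i> * of_real d)) (at t)"
      using d by (intro has_vector_derivative_mult_right has_vector_derivative_of_real)
    from field_vector_diff_chain_at[OF this DERIV_exp]
    show ?thesis by (simp add: o_def)
  qed
  ultimately have "((\<lambda>s. of_real (norm (w s)) * exp (\<i> * of_real (\<phi> s))) has_vector_derivative
      of_real (norm (w t)) * (\<i> * of_real d * ?e) + of_real n' * ?e) (at t)"
    by (rule has_vector_derivative_mult)
  then have "w' = of_real (norm (w t)) * (\<i> * of_real d * ?e) + of_real n' * ?e"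
    using w' polar by (metis (no_types, lifting) ext vector_derivative_unique_at)
  also have "\<dots> = (of_real (n' / norm (w t)) + \<i> * of_real d) * (of_real (norm (w t)) * ?e)"
    using nz by (simp add: field_simps)
  also have "of_real (norm (w t)) * ?e = w t"
    using polar[of t] by simp
  finally show ?thesis
    using nz[of t] by simp
qed

text \<open>
  The branch is the imaginary part of a continuous logarithm \<open>g\<close> of \<open>w\<close>.  It inherits
  differentiability from \<open>w\<close> because near \<open>t\<close> it agrees with \<open>s \<mapsto> g t + Ln (w s / w t)\<close>.
\<close>

lemma arg_branch_exists:
  assumes nz: "\<And>t. w t \<noteq> 0" and w': "\<And>t. (w has_vector_derivative w' t) (at t)"
  obtains \<phi> where "arg_branch w \<phi>" "\<And>t. (\<phi> has_real_derivative Im (w' t / w t)) (at t)"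
proof -
  have "continuous_on UNIV w"
    using w' by (meson continuous_at_imp_continuous_on has_vector_derivative_continuous)
  then obtain g where g: "continuous_on UNIV g" "\<And>t. w t = exp (g t)"
    using continuous_logarithm_on_contractible[of UNIV w] nz
    by (metis UNIV_I convex_UNIV convex_imp_contractible)
  have g': "(g has_vector_derivative w' t / w t) (at t)" for t
  proof -
    have "((\<lambda>s. w s / w t) has_vector_derivative w' t / w t) (at t)"
      using w' has_vector_derivative_divide by blast
    moreover have "(Ln has_field_derivative 1) (at (w t / w t))"
      using nz by (auto intro!: derivative_eq_intros)
    ultimately have "((\<lambda>s. Ln (w s / w t)) has_vector_derivative w' t / w t) (at t)"
      using field_vector_diff_chain_at[of "\<lambda>s. w s / w t" "w' t / w t" t Ln 1] by (simp add: o_def)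
    then have "((\<lambda>s. g t + Ln (w s / w t)) has_vector_derivative w' t / w t) (at t)"
      by (auto intro!: derivative_eq_intros)
    moreover have "\<forall>\<^sub>F s in nhds t. g t + Ln (w s / w t) = g s"
    proof -
      have "isCont g t"
        using g(1) by (simp add: continuous_on_eq_continuous_at)
      then have "isCont (\<lambda>s. Im (g s - g t)) t"
        unfolding isCont_def by (intro tendsto_intros)
      then have "((\<lambda>s. Im (g s - g t)) \<longlongrightarrow> 0) (nhds t)"
        using tendsto_at_iff_tendsto_nhds[of "\<lambda>s. Im (g s - g t)" t] by (simp add: isCont_def)
      then have "\<forall>\<^sub>F s in nhds t. dist (Im (g s - g t)) 0 < pi"
        by (rule tendstoD) simp
      then show ?thesis
      proof eventually_elim
        case (elim s)
        then have "Ln (exp (g s - g t)) = g s - g t"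
          by (intro Ln_exp) auto
        then show ?case
          by (simp add: g exp_diff)
      qed
    qed
    moreover have "g t + Ln (w t / w t) = g t"
      using nz by simp
    ultimately show ?thesis
      using has_vector_derivative_cong_ev[where x = t and S = UNIV
          and f = "\<lambda>s. g t + Ln (w s / w t)" and g = g] by simp
  qed
  show ?thesis
  proof (rule that)
    have "w t = of_real (norm (w t)) * exp (\<i> * of_real (Im (g t)))" for t
      unfolding g(2) norm_exp_eq_Re cis_conv_exp[symmetric] by (rule exp_eq_polar)
    moreover have "continuous_on UNIV (\<lambda>t. Im (g t))"
      using g(1) by (rule continuous_on_Im)
    ultimately show "arg_branch w (\<lambda>t. Im (g t))"
      using nz unfolding arg_branch_def is_Arg_def by blast
    show "((\<lambda>t. Im (g t)) has_real_derivative Im (w' t / w t)) (at t)" for t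
      using bounded_linear.has_vector_derivative[OF bounded_linear_Im g']
      by (simp add: has_real_derivative_iff_has_vector_derivative)
  qed
qed

section \<open>The image of a circle\<close>

lemma circle_tangent_eq:
  assumes f: "f differentiable (at z)" and z: "z = of_real r * cis \<theta>"
  shows "circle_tangent f r \<theta> = \<i> * (z * wirtinger_z f z - cnj (z * cnj (wirtinger_zbar f z)))"
proof -
  have "((\<lambda>t. of_real r * cis t) has_vector_derivative \<i> * z) (at \<theta>)"
    unfolding z cis_conv_exp
    by (auto intro!: derivative_eq_intros has_vector_derivative_real_field)
  then have "((\<lambda>t. f (of_real r * cis t)) has_vector_derivative
       frechet_derivative f (at z) (\<i> * z)) (at \<theta>)"
    using vector_derivative_diff_chain_within[of "\<lambda>t. of_real r * cis t" "\<i> * z" \<theta> UNIV f]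
      f[unfolded frechet_derivative_works]
    by (simp add: o_def z has_derivative_at_withinI)
  from vector_derivative_at[OF this] show ?thesis
    by (simp add: circle_tangent_def frechet_derivative_wirtinger[OF f] algebra_simps)
qed

text \<open>
  Along the circle, \<open>d/d\<theta>\<close> acts on an analytic function as \<open>\<i> z d/dz\<close>.  The conjugate turns the
  factor \<open>\<i>\<close> into \<open>- \<i>\<close>, which explains the plus sign between the two terms here against the minus
  sign in the tangent.
\<close>

lemma circle_tangent_has_vector_derivative:
  assumes f: "harmonic_on f S" and S: "\<And>t. of_real r * cis t \<in> S"
    and z: "z = of_real r * cis \<theta>"
    and p: "p = wirtinger_z f" and q: "q = (\<lambda>z. cnj (wirtinger_zbar f z))"
  shows "(circle_tangent f r has_vector_derivative
      - (z * (p z + z * deriv p z) + cnj (z * (q z + z * deriv q z)))) (at \<theta>)"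
proof -
  define \<gamma> where "\<gamma> t = of_real r * cis t" for t
  have "open S" and diff: "\<And>z. z \<in> S \<Longrightarrow> f differentiable (at z)"
    using f by (auto simp: harmonic_on_def)
  have \<gamma>': "(\<gamma> has_vector_derivative \<i> * z) (at \<theta>)"
    unfolding z \<gamma>_def cis_conv_exp
    by (auto intro!: derivative_eq_intros has_vector_derivative_real_field)
  have zS: "z \<in> S" and z\<gamma>: "\<gamma> \<theta> = z"
    using S by (auto simp: z \<gamma>_def)
  have chain: "((\<lambda>t. \<gamma> t * k (\<gamma> t)) has_vector_derivative \<i> * (z * (k z + z * deriv k z))) (at \<theta>)"
    if "k holomorphic_on S" for k
  proof -
    have "(k has_field_derivative deriv k z) (at z)"
      using that \<open>open S\<close> zS by (simp add: holomorphic_derivI)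
    then have "((\<lambda>z. z * k z) has_field_derivative k z + z * deriv k z) (at (\<gamma> \<theta>))"
      by (auto intro!: derivative_eq_intros simp: z\<gamma>)
    from field_vector_diff_chain_at[OF \<gamma>' this] show ?thesis
      by (simp add: o_def algebra_simps)
  qed
  have hol: "p holomorphic_on S" "q holomorphic_on S"
    unfolding p q using harmonic_on_wirtinger_holomorphic[OF f] .
  have "circle_tangent f r = (\<lambda>t. \<i> * (\<gamma> t * p (\<gamma> t) - cnj (\<gamma> t * q (\<gamma> t))))"
    using circle_tangent_eq[OF diff[OF S] refl] by (auto simp: p q \<gamma>_def)
  moreover have "((\<lambda>t. \<i> * (\<gamma> t * p (\<gamma> t) - cnj (\<gamma> t * q (\<gamma> t)))) has_vector_derivative
      \<i> * (\<i> * (z * (p z + z * deriv p z)) - cnj (\<i> * (z * (q z + z * deriv q z))))) (at \<theta>)"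
    by (intro has_vector_derivative_mult_right has_vector_derivative_diff has_vector_derivative_cnj
        chain hol)
  ultimately show ?thesis
    by (simp add: algebra_simps)
qed

section \<open>The bound for analytic functions\<close>

text \<open>
  Disc automorphisms that move \<open>z\<close> and \<open>\<omega> z\<close> to the origin reduce this to the bound
  \<open>|k' 0| \<le> 1\<close> of the Schwarz lemma.
\<close>

lemma Schwarz_Pick:
  assumes hol: "\<omega> holomorphic_on ball 0 1" and lt: "\<And>z. norm z < 1 \<Longrightarrow> norm (\<omega> z) < 1"
    and z: "norm z < 1"
  shows "norm (deriv \<omega> z) * (1 - (norm z)\<^sup>2) \<le> 1 - (norm (\<omega> z))\<^sup>2"
proof -
  let ?M = "Moebius_function 0"
  have M': "(?M w has_field_derivative (1 - cnj w * w) / (1 - cnj w * x)\<^sup>2) (at x)"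
    if "1 - cnj w * x \<noteq> 0" for w x
    unfolding Moebius_function_simple[abs_def] using that
    by (auto intro!: derivative_eq_intros simp: power2_eq_square field_simps)
  define c where "c = \<omega> z"
  have c: "norm c < 1" using lt z by (simp add: c_def)
  have sq: "cnj w * w = of_real ((norm w)\<^sup>2)" for w
    by (metis complex_norm_square mult.commute)
  have nz: "1 - cnj w * w \<noteq> 0" if "norm w < 1" for w
    using that unfolding sq by (metis abs_norm_cancel abs_square_eq_1 eq_iff_diff_eq_0 less_irrefl of_real_1 of_real_eq_iff)
  define k where "k = (\<lambda>u. ?M c (\<omega> (?M (- z) u)))"
  have hk: "k holomorphic_on ball 0 1"
  proof -
    have M: "?M (- z) holomorphic_on ball 0 1" "?M c holomorphic_on ball 0 1"
      using z c by (auto intro: Moebius_function_holomorphic)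
    have im: "?M (- z) ` ball 0 1 \<subseteq> ball 0 1" "\<omega> ` ball 0 1 \<subseteq> ball 0 1"
      using z lt Moebius_function_norm_lt_1[of "- z"] by auto
    have "(\<omega> \<circ> ?M (- z)) holomorphic_on ball 0 1"
      using holomorphic_on_compose_gen[OF M(1) hol im(1)] .
    then have "(?M c \<circ> (\<omega> \<circ> ?M (- z))) holomorphic_on ball 0 1"
    proof (rule holomorphic_on_compose_gen[OF _ M(2)])
      show "(\<omega> \<circ> ?M (- z)) ` ball 0 1 \<subseteq> ball 0 1"
        unfolding image_comp[symmetric] using im by blast
    qed
    then show ?thesis
      by (simp add: k_def o_def)
  qed
  have Mz0: "?M (- z) 0 = z" by (simp add: Moebius_function_simple)
  have "norm (deriv k 0) \<le> 1"
  proof (rule Schwarz_Lemma(2)[OF hk, of 0])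
    show "k 0 = 0" by (simp add: k_def Mz0 c_def Moebius_function_eq_zero)
    show "norm (k u) < 1" if "norm u < 1" for u
    proof -
      have "norm (?M (- z) u) < 1"
        using z that by (simp add: Moebius_function_norm_lt_1)
      then show ?thesis
        unfolding k_def using c lt by (simp add: Moebius_function_norm_lt_1)
    qed
  qed simp
  moreover have "deriv k 0 = deriv \<omega> z * of_real (1 - (norm z)\<^sup>2) / of_real (1 - (norm c)\<^sup>2)"
  proof -
    have "(\<omega> has_field_derivative deriv \<omega> z) (at (?M (- z) 0))"
      using hol z by (simp add: Mz0 holomorphic_derivI)
    from DERIV_chain2[OF this M'[of "- z" 0]]
    have "((\<lambda>u. \<omega> (?M (- z) u)) has_field_derivative deriv \<omega> z * (1 - cnj z * z)) (at 0)"
      by simp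
    moreover have "(?M c has_field_derivative 1 / (1 - cnj c * c)) (at (\<omega> (?M (- z) 0)))"
      using M'[of c c] nz[OF c] by (simp add: Mz0 power2_eq_square flip: c_def)
    ultimately have "(k has_field_derivative 1 / (1 - cnj c * c) * (deriv \<omega> z * (1 - cnj z * z))) (at 0)"
      unfolding k_def by (rule DERIV_chain2[rotated])
    from DERIV_imp_deriv[OF this] show ?thesis
      by (simp add: sq)
  qed
  ultimately have "norm (deriv \<omega> z) * \<bar>1 - (norm z)\<^sup>2\<bar> / \<bar>1 - (norm c)\<^sup>2\<bar> \<le> 1"
    by (simp only: norm_mult norm_divide norm_of_real)
  moreover have "(norm z)\<^sup>2 < 1" "(norm c)\<^sup>2 < 1"
    using z c by (simp_all add: power_less_one_iff abs_square_less_1)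
  ultimately show ?thesis
    by (simp add: c_def field_simps)
qed

text \<open>
  For \<open>F' = 1 + \<omega>\<close> the conclusion says that \<open>z F'' / F'\<close> has modulus less than \<open>1\<close>, so that
  \<open>1 + z F'' / F'\<close>, the curvature expression of \<open>F\<close>, has positive real part.
\<close>

lemma analytic_curvature_bound:
  assumes hol: "\<omega> holomorphic_on ball 0 1" and lt: "\<And>z. norm z < 1 \<Longrightarrow> norm (\<omega> z) < 1"
    and "\<omega> 0 = 0" and z: "norm z < 1/2"
  shows "norm (z * deriv \<omega> z) < norm (1 + \<omega> z)"
proof -
  define r s where "r = norm z" and "s = norm (\<omega> z)"
  have r: "0 \<le> r" "r < 1/2" and "0 \<le> s" using z by (auto simp: r_def s_def)
  have "s \<le> r"
    unfolding r_def s_def using Schwarz_Lemma(1)[OF hol \<open>\<omega> 0 = 0\<close> lt] z by auto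
  have "norm (deriv \<omega> z) * (1 - r\<^sup>2) \<le> 1 - s\<^sup>2"
    unfolding r_def s_def using z by (intro Schwarz_Pick hol lt) auto
  then have "r * (norm (deriv \<omega> z) * (1 - r\<^sup>2)) \<le> r * (1 - s\<^sup>2)"
    using r by (intro mult_left_mono)
  then have "norm (z * deriv \<omega> z) * (1 - r\<^sup>2) \<le> r * (1 + s) * (1 - s)"
    by (simp add: norm_mult r_def power2_eq_square algebra_simps)
  also have "r * (1 + s) \<le> r * (1 + r)"
    using r \<open>s \<le> r\<close> by (intro mult_left_mono) auto
  also have "r * (1 + r) < 1 - r\<^sup>2"
  proof -
    have "0 < (1 + r) * (1 - 2 * r)" using r by (intro mult_pos_pos) auto
    then show ?thesis by (simp add: power2_eq_square algebra_simps)
  qed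
  finally have "norm (z * deriv \<omega> z) * (1 - r\<^sup>2) < (1 - r\<^sup>2) * (1 - s)"
    using r \<open>s \<le> r\<close> by simp
  then have "norm (z * deriv \<omega> z) < 1 - s"
    using r by (simp add: mult.commute[of "1 - r\<^sup>2"] mult_less_cancel_right power_le_one_iff abs_square_le_1
       split: if_splits)
  also have "1 - s \<le> norm (1 + \<omega> z)"
    unfolding s_def using norm_triangle_ineq2[of 1 "- \<omega> z"] by simp
  finally show ?thesis .
qed

section \<open>From analytic to harmonic functions\<close>

text \<open>
  With \<open>W = P - cnj Q\<close>, the rotation \<open>\<epsilon> = W / cnj W\<close> satisfies
  \<open>(P + \<epsilon> Q) cnj W = |P|\<^sup>2 - |Q|\<^sup>2\<close>, so it makes the tangent of \<open>h + \<epsilon> g\<close> a positive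
  multiple of the tangent of \<open>h + cnj g\<close>.  Geometrically, both functions have the same
  component normal to this common tangent direction, hence curve to the same side of it.
\<close>

lemma Re_divide_pos_of_rotations:
  assumes pos: "\<And>\<epsilon>. norm \<epsilon> = 1 \<Longrightarrow> Re ((A + \<epsilon> * B) / (P + \<epsilon> * Q)) > 0"
    and lt: "norm Q < norm P"
  shows "Re ((A + cnj B) / (P - cnj Q)) > 0"
proof -
  define W where "W = P - cnj Q"
  have "W \<noteq> 0"
  proof
    assume "W = 0"
    then have "norm P = norm (cnj Q)" by (simp add: W_def)
    then show False using lt by simp
  qed
  define c where "c = ((norm P)\<^sup>2 - (norm Q)\<^sup>2) / (norm W)\<^sup>2"
  have "c > 0" using lt \<open>W \<noteq> 0\<close> by (simp add: c_def power_strict_mono)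
  define \<epsilon> where "\<epsilon> = W / cnj W"
  have "(P + \<epsilon> * Q) * cnj W = P * cnj P - Q * cnj Q"
    using \<open>W \<noteq> 0\<close> by (simp add: \<epsilon>_def distrib_right) (simp add: W_def algebra_simps)
  also have "\<dots> = of_real c * (W * cnj W)"
    using \<open>W \<noteq> 0\<close> by (simp add: c_def flip: complex_norm_square)
  finally have PQ: "P + \<epsilon> * Q = of_real c * W"
    using \<open>W \<noteq> 0\<close> by simp
  have "norm \<epsilon> = 1" using \<open>W \<noteq> 0\<close> by (simp add: \<epsilon>_def norm_divide)
  from pos[OF this] have "0 < Re ((A + \<epsilon> * B) / W / of_real c)"
    unfolding PQ by (simp only: divide_divide_eq_left mult.commute[of W])
  also have "\<dots> = Re ((A + \<epsilon> * B) / W) / c"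
    by (rule Re_divide_of_real)
  finally have "0 < Re ((A + \<epsilon> * B) / W)"
    using \<open>c > 0\<close> by (simp add: zero_less_divide_iff)
  also have "(A + \<epsilon> * B) / W = A / W + cnj (cnj B / W)"
    using \<open>W \<noteq> 0\<close> by (simp add: \<epsilon>_def field_simps)
  also have "Re \<dots> = Re ((A + cnj B) / W)"
    by (simp only: add_divide_distrib plus_complex.sel cnj.sel)
  finally show ?thesis by (simp add: W_def)
qed

text \<open>
  The class condition \<open>|p - 1| + |q| < 1\<close> bounds \<open>p - 1 + \<epsilon> q\<close> by \<open>1\<close> for all unimodular \<open>\<epsilon>\<close>
  at once, and it forces \<open>|q| < |p|\<close>; these are the two hypotheses of the rotation argument.
\<close>

lemma F_H0_curvature_pos:
  assumes f: "f \<in> F_H0" and z: "z \<noteq> 0" "norm z < 1/2"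
    and p: "p = wirtinger_z f" and q: "q = (\<lambda>z. cnj (wirtinger_zbar f z))"
  shows "norm (q z) < norm (p z)"
    and "Re ((z * (p z + z * deriv p z) + cnj (z * (q z + z * deriv q z))) /
             (z * p z - cnj (z * q z))) > 0"
proof -
  have har: "harmonic_on f (ball 0 1)" and "p 0 = 1" "q 0 = 0"
    and bd: "\<And>z. norm z < 1 \<Longrightarrow> norm (p z - 1) + norm (q z) < 1"
    using f by (auto simp: F_H0_def p q algebra_simps)
  have hol: "p holomorphic_on ball 0 1" "q holomorphic_on ball 0 1"
    unfolding p q using harmonic_on_wirtinger_holomorphic[OF har] .
  show qp: "norm (q z) < norm (p z)"
    using bd[of z] z norm_triangle_ineq2[of 1 "1 - p z"] by (simp add: norm_minus_commute)
  show "Re ((z * (p z + z * deriv p z) + cnj (z * (q z + z * deriv q z))) /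
             (z * p z - cnj (z * q z))) > 0"
  proof (rule Re_divide_pos_of_rotations)
    fix \<epsilon> :: complex
    assume \<epsilon>: "norm \<epsilon> = 1"
    define \<omega> where "\<omega> = (\<lambda>z. p z - 1 + \<epsilon> * q z)"
    have h\<omega>: "\<omega> holomorphic_on ball 0 1"
      unfolding \<omega>_def by (intro holomorphic_intros hol)
    have "norm (\<omega> w) < 1" if "norm w < 1" for w
      using bd[OF that] norm_triangle_ineq[of "p w - 1" "\<epsilon> * q w"] \<epsilon>
      by (simp add: \<omega>_def norm_mult)
    then have less: "norm (z * deriv \<omega> z) < norm (1 + \<omega> z)"
      using h\<omega> z \<open>p 0 = 1\<close> \<open>q 0 = 0\<close>
      by (intro analytic_curvature_bound) (auto simp: \<omega>_def)
    have "(p has_field_derivative deriv p z) (at z)" "(q has_field_derivative deriv q z) (at z)"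
      using hol z by (auto intro!: holomorphic_derivI[of _ "ball 0 1"])
    then have d\<omega>: "deriv \<omega> z = deriv p z + \<epsilon> * deriv q z"
      unfolding \<omega>_def by (auto intro!: DERIV_imp_deriv derivative_eq_intros)
    let ?x = "z * deriv \<omega> z / (1 + \<omega> z)"
    have nz: "1 + \<omega> z \<noteq> 0" using less by auto
    have "(z * (p z + z * deriv p z) + \<epsilon> * (z * (q z + z * deriv q z))) / (z * p z + \<epsilon> * (z * q z))
        = (z * (1 + \<omega> z + z * deriv \<omega> z)) / (z * (1 + \<omega> z))"
      unfolding d\<omega> by (rule arg_cong2[of _ _ _ _ "(/)"]) (simp_all add: \<omega>_def algebra_simps)
    also have "\<dots> = 1 + ?x"
      by (simp only: mult_divide_mult_cancel_left[OF z(1)] add_divide_distrib[of "1 + \<omega> z"]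
          divide_self[OF nz])
    finally have eq: "(z * (p z + z * deriv p z) + \<epsilon> * (z * (q z + z * deriv q z)))
        / (z * p z + \<epsilon> * (z * q z)) = 1 + ?x" .
    have "norm ?x < 1"
      using less nz by (simp add: norm_divide)
    then show "Re ((z * (p z + z * deriv p z) + \<epsilon> * (z * (q z + z * deriv q z)))
        / (z * p z + \<epsilon> * (z * q z))) > 0"
      unfolding eq using abs_Re_le_cmod[of ?x] by simp
  next
    show "norm (z * q z) < norm (z * p z)"
      using qp z by (simp add: norm_mult)
  qed
qed

lemma F_H0_convex_in_half_disc:
  assumes f: "f \<in> F_H0"
  shows "convex_in_disc f (1/2)"
  unfolding convex_in_disc_def
proof (intro allI impI)
  fix r :: real
  assume r: "0 < r \<and> r < 1/2"
  define p q where "p = wirtinger_z f" and "q = (\<lambda>z. cnj (wirtinger_zbar f z))"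
  define z where "z t = of_real r * cis t" for t
  have z: "z t \<noteq> 0" "norm (z t) < 1/2" for t
    using r by (auto simp: z_def norm_mult)
  have har: "harmonic_on f (ball 0 1)" using f by (simp add: F_H0_def)
  have zS: "of_real r * cis t \<in> ball 0 1" for t
    using z(2)[of t] by (simp add: z_def)
  define w w' where "w t = \<i> * (z t * p (z t) - cnj (z t * q (z t)))"
    and "w' t = - (z t * (p (z t) + z t * deriv p (z t)) + cnj (z t * (q (z t) + z t * deriv q (z t))))" for t
  have curv: "norm (q (z t)) < norm (p (z t))" "Im (w' t / w t) > 0" for t
  proof -
    have quot: "- N / (\<i> * D) = \<i> * (N / D)" for N D :: complex
      by (cases "D = 0") (simp_all add: field_simps)
    show "norm (q (z t)) < norm (p (z t))" "Im (w' t / w t) > 0"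
      using F_H0_curvature_pos[OF f z[of t] p_def q_def] unfolding w_def w'_def quot Im_i_times by simp_all
  qed
  have w: "circle_tangent f r = w"
    using circle_tangent_eq[of f] har zS by (auto simp: w_def z_def p_def q_def harmonic_on_def)
  have "w t \<noteq> 0" for t
  proof
    assume "w t = 0"
    then have "norm (z t * p (z t)) = norm (cnj (z t * q (z t)))" by (simp add: w_def)
    then show False using curv(1)[of t] z(1)[of t] by (simp add: norm_mult)
  qed
  moreover have "(w has_vector_derivative w' t) (at t)" for t
    using circle_tangent_has_vector_derivative[OF har zS _ p_def q_def, where \<theta> = t and z = "z t"]
    unfolding w w'_def by (simp add: z_def)
  ultimately obtain \<phi> where "arg_branch w \<phi>" "\<And>t. (\<phi> has_real_derivative Im (w' t / w t)) (at t)"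
    using arg_branch_exists by blast
  then show "\<exists>\<phi>. arg_branch (circle_tangent f r) \<phi> \<and>
         (\<forall>\<theta>\<in>{0..2 * pi}. \<exists>d>0. (\<phi> has_real_derivative d) (at \<theta>))"
    using curv(2) w by auto
qed

section \<open>Sharpness\<close>

lemma holomorphic_partials:
  assumes "(f has_field_derivative f') (at z)"
  shows "partial_x f z = f'" "partial_y f z = \<i> * f'"
proof -
  have "frechet_derivative f (at z) = (*) f'"
    using assms unfolding has_field_derivative_def by (rule frechet_derivative_at[symmetric])
  then show "partial_x f z = f'" "partial_y f z = \<i> * f'"
    by (simp_all add: partial_x_def partial_y_def)
qed

definition extremal :: "complex \<Rightarrow> complex" where
  "extremal z = z + z\<^sup>2 / 2"

lemma extremal_partials:
  "partial_x extremal = (\<lambda>z. 1 + z)" "partial_y extremal = (\<lambda>z. \<i> * (1 + z))"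
  "partial_x (\<lambda>z. 1 + z) = (\<lambda>z. 1)" "partial_y (\<lambda>z. 1 + z) = (\<lambda>z. \<i>)"
  "partial_x (\<lambda>z. \<i> * (1 + z)) = (\<lambda>z. \<i>)" "partial_y (\<lambda>z. \<i> * (1 + z)) = (\<lambda>z. - 1)"
proof -
  have 1: "(extremal has_field_derivative 1 + z) (at z)" for z
    unfolding extremal_def[abs_def] by (auto intro!: derivative_eq_intros)
  have 2: "((\<lambda>z. 1 + z) has_field_derivative 1) (at z)" for z :: complex
    by (auto intro!: derivative_eq_intros)
  have 3: "((\<lambda>z. \<i> * (1 + z)) has_field_derivative \<i>) (at z)" for z
    by (auto intro!: derivative_eq_intros)
  show "partial_x extremal = (\<lambda>z. 1 + z)" "partial_y extremal = (\<lambda>z. \<i> * (1 + z))"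
    "partial_x (\<lambda>z. 1 + z) = (\<lambda>z. 1)" "partial_y (\<lambda>z. 1 + z) = (\<lambda>z. \<i>)"
    "partial_x (\<lambda>z. \<i> * (1 + z)) = (\<lambda>z. \<i>)" "partial_y (\<lambda>z. \<i> * (1 + z)) = (\<lambda>z. - 1)"
    using holomorphic_partials[OF 1] holomorphic_partials[OF 2] holomorphic_partials[OF 3]
    by auto
qed

lemma extremal_wirtinger:
  "wirtinger_z extremal = (\<lambda>z. 1 + z)" "wirtinger_zbar extremal = (\<lambda>z. 0)"
  by (auto simp: wirtinger_z_def wirtinger_zbar_def extremal_partials algebra_simps)

lemma extremal_in_F_H0: "extremal \<in> F_H0"
proof -
  have "extremal differentiable (at z)" "(\<lambda>z. 1 + z) differentiable (at z)"
    "(\<lambda>z. \<i> * (1 + z)) differentiable (at z)" for z :: complex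
    unfolding extremal_def[abs_def] by (auto intro!: derivative_intros)
  then have "harmonic_on extremal (ball 0 1)"
    by (simp add: harmonic_on_def extremal_partials)
  then show ?thesis
    by (simp add: F_H0_def extremal_wirtinger) (simp add: extremal_def)
qed

text \<open>
  On the circle of radius \<open>r > 1/2\<close> the argument of the tangent decreases at \<open>\<theta> = \<pi>\<close>, where its
  derivative is \<open>(1 - 2 r) / (1 - r)\<close>.
\<close>

lemma extremal_not_convex:
  assumes \<rho>: "1/2 < \<rho>" "\<rho> \<le> 1"
  shows "\<not> convex_in_disc extremal \<rho>"
proof
  assume convex: "convex_in_disc extremal \<rho>"
  define r where "r = (1/2 + \<rho>) / 2"
  have r: "0 < r" "1/2 < r" "r < \<rho>" "r < 1" using \<rho> by (auto simp: r_def)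
  obtain \<phi> where \<phi>: "arg_branch (circle_tangent extremal r) \<phi>"
    and "\<forall>\<theta>\<in>{0..2 * pi}. \<exists>d>0. (\<phi> has_real_derivative d) (at \<theta>)"
    using convex r unfolding convex_in_disc_def by blast
  moreover have "pi \<in> {0..2 * pi}" by simp
  ultimately obtain d where d: "d > 0" "(\<phi> has_real_derivative d) (at pi)"
    by blast
  have har: "harmonic_on extremal (ball 0 1)"
    using extremal_in_F_H0 by (simp add: F_H0_def)
  have S: "of_real r * cis t \<in> ball 0 1" for t using r by (simp add: norm_mult)
  have z: "- of_real r = of_real r * cis pi" by simp
  have "circle_tangent extremal r pi = - (\<i> * of_real (r * (1 - r)))"
    using circle_tangent_eq[OF _ z, of extremal] har S[of pi]
    by (simp add: harmonic_on_def extremal_wirtinger algebra_simps)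
  moreover have "(circle_tangent extremal r has_vector_derivative of_real (r * (1 - 2 * r))) (at pi)"
    using circle_tangent_has_vector_derivative[OF har S z refl refl]
    by (simp add: extremal_wirtinger algebra_simps)
  ultimately have "d = Im (of_real (r * (1 - 2 * r)) / - (\<i> * of_real (r * (1 - r))))"
    using arg_branch_derivative[OF \<phi> _ d(2)] by simp
  also have "of_real (r * (1 - 2 * r)) / - (\<i> * of_real (r * (1 - r)))
      = \<i> * complex_of_real ((1 - 2 * r) / (1 - r))"
    using r by (simp add: field_simps)
  also have "Im \<dots> = (1 - 2 * r) / (1 - r)"
    by simp
  also have "\<dots> < 0"
    using r by (simp add: divide_less_0_iff)
  finally show False using d(1) by simp
qed

theorem theorem3p2:
  "is_radius_of_convexity F_H0 (1/2) \<and>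
   (\<forall>f\<in>F_H0. convex_in_disc f (1/2)) \<and>
   \<not> (\<exists>\<rho>\<in>{1/2<..1}. \<forall>f\<in>F_H0. convex_in_disc f \<rho>)"
proof -
  have no: "\<rho> \<le> 1/2" if "\<rho> \<in> {0<..1}" "\<forall>f\<in>F_H0. convex_in_disc f \<rho>" for \<rho>
    using extremal_not_convex[of \<rho>] extremal_in_F_H0 that by (cases "\<rho> \<le> 1/2") auto
  have "\<not> (\<exists>\<rho>\<in>{1/2<..1}. \<forall>f\<in>F_H0. convex_in_disc f \<rho>)"
  proof
    assume "\<exists>\<rho>\<in>{1/2<..1}. \<forall>f\<in>F_H0. convex_in_disc f \<rho>"
    then obtain \<rho> :: real where "\<rho> \<in> {1/2<..1}" "\<forall>f\<in>F_H0. convex_in_disc f \<rho>"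
      by blast
    with no[of \<rho>] show False by auto
  qed
  moreover have "is_radius_of_convexity F_H0 (1/2)"
    unfolding is_radius_of_convexity_def using no F_H0_convex_in_half_disc by simp
  ultimately show ?thesis
    using F_H0_convex_in_half_disc by blast
qed

end
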